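(* Let $g:\mathbb{C}\to\mathbb{C}$ be an analytic function of exponential type $c<\infty$, i.e. $|g^{(k)}(z)|^{1/k}\to c$ as $k\to\infty$ for every $z\in\mathbb{C}$. Then for all $t\ge 0$ and $z\in\mathbb{C}$ $$\lim_{n\to\infty}\mathbb{E}[g(z+W_n(t))]-g(z)=\frac{\alpha}{N!}\int_0^t\lim_{n\to\infty}\mathbb{E}[\partial^N g(z+W_n(s))]\,ds.$$ Setting $u(t,z)=\lim_{n\to\infty}\mathbb{E}[g(z+W_n(t))]$, this is equivalent to saying that $u$ is a classical solution of the $N$-th order Cauchy problem $$\partial_t u(t,z)=\frac{\alpha}{N!}\,\partial^N u(t,z),\qquad u(0,z)=g(z).$$
   Context: Let $N>2$ be an integer and $\alpha\in\mathbb{C}$; fix an $N$-th root $\alpha^{1/N}$ of $\alpha$. Let $\xi$ be a random variable uniformly distributed on $\{\alpha^{1/N}e^{2\pi i k/N}:k=0,\dots,N-1\}$, let $(\xi_k)_{k\ge1}$ be i.i.d. copies of $\xi$ on a probability space, and for each integer $n\ge1$ and real $t\ge0$ set $W_n(t)=n^{-1/N}\sum_{k=1}^{\lfloor nt\rfloor}\xi_k$. Here $\partial^N$ denotes the $N$-th complex derivative with respect to the space variable $z\in\mathbb{C}$, and the time variable ranges over $t\in[0,\infty)$. *)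

theory Defs
  imports "HOL-Probability.Probability" "HOL-Complex_Analysis.Complex_Analysis"
begin

definition scaled_roots :: "nat \<Rightarrow> complex \<Rightarrow> complex set" where
  "scaled_roots N a = (\<lambda>k. a * exp (2 * complex_of_real pi * \<i> * of_nat k / of_nat N)) ` {0..<N}"

(* A degenerate set (a = 0) gives the point mass at 0. *)
definition uniform_scaled_roots :: "nat \<Rightarrow> complex \<Rightarrow> complex measure" where
  "uniform_scaled_roots N a = distr (measure_pmf (pmf_of_set (scaled_roots N a))) borel (\<lambda>x. x)"

definition scaled_walk ::
  "nat \<Rightarrow> (nat \<Rightarrow> 'a \<Rightarrow> complex) \<Rightarrow> nat \<Rightarrow> real \<Rightarrow> 'a \<Rightarrow> complex" where
  "scaled_walk N \<xi> n t \<omega> =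
     complex_of_real (real n powr (- 1 / real N)) * (\<Sum>k=1..nat \<lfloor>real n * t\<rfloor>. \<xi> k \<omega>)"

definition exponential_type :: "(complex \<Rightarrow> complex) \<Rightarrow> real \<Rightarrow> bool" where
  "exponential_type g c \<longleftrightarrow>
     g analytic_on UNIV \<and>
     (\<forall>z. (\<lambda>k. root k (cmod ((deriv ^^ k) g z))) \<longlonglongrightarrow> c)"

definition walk_expectation ::
  "'a measure \<Rightarrow> nat \<Rightarrow> (nat \<Rightarrow> 'a \<Rightarrow> complex) \<Rightarrow> (complex \<Rightarrow> complex) \<Rightarrow> nat \<Rightarrow> real \<Rightarrow> complex \<Rightarrow> complex"
  where
  "walk_expectation M N \<xi> f n t z = (\<integral>\<omega>. f (z + scaled_walk N \<xi> n t \<omega>) \<partial>M)"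

(* lim is unspecified when the sequence diverges and the integral is 0 when the integrand is
   not integrable, so statements about this value should assert limit_expectation_exists. *)
definition limit_expectation ::
  "'a measure \<Rightarrow> nat \<Rightarrow> (nat \<Rightarrow> 'a \<Rightarrow> complex) \<Rightarrow> (complex \<Rightarrow> complex) \<Rightarrow> real \<Rightarrow> complex \<Rightarrow> complex"
  where
  "limit_expectation M N \<xi> f t z = lim (\<lambda>n. walk_expectation M N \<xi> f n t z)"

definition limit_expectation_exists ::
  "'a measure \<Rightarrow> nat \<Rightarrow> (nat \<Rightarrow> 'a \<Rightarrow> complex) \<Rightarrow> (complex \<Rightarrow> complex) \<Rightarrow> real \<Rightarrow> complex \<Rightarrow> bool"
  where
  "limit_expectation_exists M N \<xi> f t z \<longleftrightarrow>
     (\<forall>n\<ge>1. integrable M (\<lambda>\<omega>. f (z + scaled_walk N \<xi> n t \<omega>))) \<and>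
     convergent (\<lambda>n. walk_expectation M N \<xi> f n t z)"

(* Every derivative up to those in the equation exists and is jointly continuous on
   [0,\<infinity>) \<times> C. Once complex differentiable on C means infinitely often differentiable, and
   continuity of the time derivative follows from the equation. The time derivative at t = 0
   is one-sided. *)
definition classical_solution ::
  "nat \<Rightarrow> complex \<Rightarrow> (complex \<Rightarrow> complex) \<Rightarrow> (real \<Rightarrow> complex \<Rightarrow> complex) \<Rightarrow> bool" where
  "classical_solution N \<alpha> g u \<longleftrightarrow>
     (\<forall>t\<ge>0. u t holomorphic_on UNIV) \<and>
     (\<forall>j\<le>N. continuous_on ({0..} \<times> UNIV) (\<lambda>(t, z). (deriv ^^ j) (u t) z)) \<and>
     (\<forall>t\<ge>0. \<forall>z. ((\<lambda>s. u s z) has_vector_derivative (\<alpha> / fact N * (deriv ^^ N) (u t) z))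
                    (at t within {0..})) \<and>
     (\<forall>z. u 0 z = g z)"

definition integrated_equation ::
  "nat \<Rightarrow> complex \<Rightarrow> (complex \<Rightarrow> complex) \<Rightarrow> (real \<Rightarrow> complex \<Rightarrow> complex) \<Rightarrow>
   (real \<Rightarrow> complex \<Rightarrow> complex) \<Rightarrow> bool" where
  "integrated_equation N \<alpha> g u v \<longleftrightarrow>
     (\<forall>t\<ge>0. \<forall>z. set_integrable lborel {0..t} (\<lambda>s. v s z) \<and>
        u t z - g z = \<alpha> / fact N * (LINT s:{0..t}|lborel. v s z))"

end

theory Submission imports Defs begin

text \<open>
  Write \<open>D\<close> for complex differentiation. For independent steps, the exponential
  \<open>w \<mapsto> exp (x * w)\<close> is an eigenfunction of averaging over the walk:
  \<open>E (exp (x * W\<^sub>n(t))) = \<phi> (x * n powr (- 1 / N)) ^ \<lfloor>n * t\<rfloor>\<close>, where \<open>\<phi>\<close> is the transform of one step.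
  A moment of a step vanishes unless its order \<open>i\<close> is a multiple of \<open>N\<close>, because the \<open>i\<close>-th powers
  of the \<open>N\<close>-th roots of unity otherwise sum to zero; hence \<open>\<phi> y = 1 + \<alpha> * y ^ N / N! + O(y ^ (2 * N))\<close>.
  The scaling turns the second term into one of size \<open>1 / n\<close>, and compounding it \<open>n * t\<close> times gives
  the limit \<open>exp (t * \<alpha> / N! * x ^ N)\<close>. This is a central limit theorem with \<open>x ^ N\<close> in the place
  of the quadratic exponent (\<open>scaled_step_transform_expansion\<close>, \<open>compound_power_uniform_limit\<close>).

  When \<open>N > 2\<close>, \<open>t > 0\<close> and \<open>\<alpha> \<noteq> 0\<close>, the walk spreads out on the scale \<open>n powr (1 / 2 - 1 / N)\<close>, so
  its laws do not converge and weak convergence is of no use for passing from exponentials to a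
  general \<open>g\<close>. The passage goes through moments, which converge by cancellation. The convergence is uniform for \<open>x\<close> in any fixed disc, so Cauchy's formulas make
  every Taylor coefficient \<open>E (W\<^sub>n(t) ^ k) / k!\<close> converge to the corresponding one of the limit and
  bound it by \<open>B / r ^ k\<close>, for any \<open>r\<close> and uniformly in \<open>n\<close>. Since \<open>g\<close> has exponential type, its
  derivatives at a point grow at most like \<open>R ^ k\<close>; with \<open>r = 2 * R\<close> the series
  \<open>\<Sum>k. (D ^ k g) z * E (W\<^sub>n(t) ^ k) / k!\<close> has a geometric majorant, and its limit may be taken
  termwise (\<open>walk_expectation_tendsto\<close>). The result is \<open>exp (t * \<alpha> / N! * D ^ N) g\<close>, defined by
  the exponential series (\<open>exp_deriv\<close>).

  For functions of exponential type, this series and its termwise derivatives converge locally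
  uniformly in time and space. Differentiating in time therefore applies \<open>\<alpha> / N! * D ^ N\<close>, and this
  operator commutes with the exponential, so that \<open>D ^ N\<close> of the limit for \<open>g\<close> is the limit for
  \<open>D ^ N g\<close>. This is the Cauchy problem, and its integrated form follows by the fundamental
  theorem of calculus. The equivalence of the two forms holds because both have been established.
\<close>

section \<open>Entire functions of exponential type\<close>

text \<open>Exponential type in a quantitative form that is uniform in \<open>z\<close> and, unlike the existence of the limit
in the root test, is visibly inherited by derivatives. The condition \<open>1 \<le> R\<close> makes \<open>R\<close> usable
as a positive radius.\<close>

definition exponential_bound :: "(complex \<Rightarrow> complex) \<Rightarrow> real \<Rightarrow> real \<Rightarrow> bool" where
  "exponential_bound f K R \<longleftrightarrow> f holomorphic_on UNIV \<and> 0 \<le> K \<and> 1 \<le> R \<and>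
     (\<forall>k z. cmod ((deriv ^^ k) f z) \<le> K * R ^ k * exp (R * cmod z))"

lemma higher_deriv_higher_deriv: "(deriv ^^ m) ((deriv ^^ n) f) = (deriv ^^ (m + n)) f"
  by (simp add: funpow_add)

lemma entire_higher_deriv:
  "f holomorphic_on UNIV \<Longrightarrow> (deriv ^^ k) f holomorphic_on UNIV"
  by (rule holomorphic_higher_deriv) auto

lemma entire_taylor_sums:
  assumes "f holomorphic_on UNIV"
  shows "(\<lambda>k. (deriv ^^ k) f z / fact k * w ^ k) sums f (z + w)"
  using holomorphic_power_series[of f z "cmod w + 1" "z + w"] assms
  by (simp add: dist_norm holomorphic_on_subset[OF assms])

lemma exponential_bound_deriv:
  assumes "exponential_bound f K R"
  shows "exponential_bound ((deriv ^^ j) f) (K * R ^ j) R"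
proof -
  have "cmod ((deriv ^^ k) ((deriv ^^ j) f) z) \<le> K * R ^ j * R ^ k * exp (R * cmod z)" for k z
    using assms[unfolded exponential_bound_def]
    by (metis (no_types, lifting) higher_deriv_higher_deriv mult.assoc power_add add.commute)
  then show ?thesis
    using assms entire_higher_deriv unfolding exponential_bound_def by auto
qed

lemma exp_sums_real: "(\<lambda>i. x ^ i / fact i) sums exp (x::real)"
  using exp_converges[of x] by (simp add: field_simps)

text \<open>The growth of the derivatives at the origin alone suffices: the Taylor series of the \<open>k\<close>-th
derivative is dominated termwise by \<open>K * R ^ k\<close> times the exponential series of \<open>R * cmod z\<close>.\<close>

lemma exponential_type_imp_bound:
  assumes "exponential_type g c"
  obtains K R where "exponential_bound g K R"
proof -
  have hol: "g holomorphic_on UNIV"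
    using assms by (simp add: exponential_type_def analytic_imp_holomorphic)
  define R where "R = \<bar>c\<bar> + 1"
  define d where "d k = cmod ((deriv ^^ k) g 0)" for k
  have "(\<lambda>k. root k (d k)) \<longlonglongrightarrow> c"
    using assms by (simp add: exponential_type_def d_def)
  then have "eventually (\<lambda>k. root k (d k) < R) sequentially"
    by (rule order_tendstoD) (simp add: R_def)
  then obtain k0 where k0: "\<And>k. k \<ge> k0 \<Longrightarrow> root k (d k) < R"
    by (auto simp: eventually_sequentially)
  \<comment> \<open>The root test controls all but finitely many derivatives; the constant absorbs the rest.\<close>
  define K where "K = 1 + (\<Sum>k\<le>k0. d k)"
  have R1: "1 \<le> R" by (simp add: R_def)
  have d0: "0 \<le> d k" for k by (simp add: d_def)
  have K1: "1 \<le> K" by (simp add: K_def d0 sum_nonneg)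
  have dK: "d k \<le> K * R ^ k" for k
  proof (cases "k \<le> k0")
    case True
    then have "d k \<le> (\<Sum>k\<le>k0. d k)"
      using d0 by (intro member_le_sum) auto
    also have "\<dots> \<le> K * 1" by (simp add: K_def)
    also have "\<dots> \<le> K * R ^ k" using R1 K1 by (intro mult_left_mono) (auto)
    finally show ?thesis .
  next
    case False
    then have k: "k > 0" by simp
    have "d k = root k (d k) ^ k" using k d0 by simp
    also have "\<dots> \<le> R ^ k" using k0[of k] False d0 k by (intro power_mono) auto
    also have "\<dots> \<le> K * R ^ k" using K1 R1 by simp
    finally show ?thesis .
  qed
  have "cmod ((deriv ^^ k) g z) \<le> K * R ^ k * exp (R * cmod z)" for k z
  proof -
    have s: "(\<lambda>i. (deriv ^^ i) ((deriv ^^ k) g) 0 / fact i * z ^ i) sums (deriv ^^ k) g (0 + z)"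
      by (rule entire_taylor_sums[OF entire_higher_deriv[OF hol]])
    have b: "norm ((deriv ^^ i) ((deriv ^^ k) g) 0 / fact i * z ^ i)
        \<le> K * R ^ k * ((R * cmod z) ^ i / fact i)" for i
    proof -
      have "norm ((deriv ^^ i) ((deriv ^^ k) g) 0 / fact i * z ^ i) = d (i + k) * (cmod z ^ i / fact i)"
        by (simp add: higher_deriv_higher_deriv d_def norm_mult norm_divide norm_power)
      also have "\<dots> \<le> (K * R ^ (i + k)) * (cmod z ^ i / fact i)"
        by (intro mult_right_mono dK) auto
      finally show ?thesis by (simp add: power_add power_mult_distrib mult_ac)
    qed
    have t: "(\<lambda>i. K * R ^ k * ((R * cmod z) ^ i / fact i)) sums (K * R ^ k * exp (R * cmod z))"
      by (intro sums_mult exp_sums_real)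
    show ?thesis
      using norm_sums_le[OF s t b] by simp
  qed
  then have "exponential_bound g K R"
    using hol K1 R1 by (simp add: exponential_bound_def)
  then show ?thesis by (rule that)
qed

section \<open>The exponential of a power of the derivative\<close>

text \<open>The operator \<open>exp (s * D ^ N)\<close>, with \<open>D\<close> the complex derivative, applied to \<open>f\<close>. The parameter \<open>s\<close>
is complex so that differentiation in \<open>s\<close> is also complex differentiation of a power series.\<close>

definition exp_deriv :: "nat \<Rightarrow> (complex \<Rightarrow> complex) \<Rightarrow> complex \<Rightarrow> complex \<Rightarrow> complex" where
  "exp_deriv N f s z = (\<Sum>i. s ^ i / fact i * (deriv ^^ (N * i)) f z)"

text \<open>On any bicylinder the terms are dominated by those of a numerical exponential series. Continuity and
both termwise differentiations rest on this majorant.\<close>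

lemma exp_deriv_term_bound:
  assumes f: "exponential_bound f K R" and "cmod s \<le> S" "cmod z \<le> r"
  shows "cmod (s ^ i / fact i * (deriv ^^ (N * i)) f z)
       \<le> K * exp (R * r) * ((S * R ^ N) ^ i / fact i)"
proof -
  have KR: "0 \<le> K" "1 \<le> R" using f by (auto simp: exponential_bound_def)
  have S: "0 \<le> S" using assms(2) norm_ge_zero[of s] by linarith
  have "cmod ((deriv ^^ (N * i)) f z) \<le> K * R ^ (N * i) * exp (R * cmod z)"
    using f by (auto simp: exponential_bound_def)
  also have "\<dots> \<le> K * R ^ (N * i) * exp (R * r)"
    using KR assms by (intro mult_left_mono) auto
  finally have "cmod s ^ i / fact i * cmod ((deriv ^^ (N * i)) f z)
      \<le> S ^ i / fact i * (K * R ^ (N * i) * exp (R * r))"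
    using assms KR S by (intro mult_mono divide_right_mono power_mono) auto
  then show ?thesis
    by (simp add: norm_mult norm_divide norm_power power_mult_distrib power_mult mult_ac)
qed

lemma summable_majorant: "summable (\<lambda>i. C * ((x::real) ^ i / fact i))"
  by (intro summable_mult sums_summable[OF exp_sums_real])

lemma exp_deriv_sums:
  assumes "exponential_bound f K R"
  shows "(\<lambda>i. s ^ i / fact i * (deriv ^^ (N * i)) f z) sums exp_deriv N f s z"
  unfolding exp_deriv_def
  by (rule summable_sums, rule summable_comparison_test'[OF summable_majorant])
     (rule exp_deriv_term_bound[OF assms order_refl order_refl])

lemma continuous_on_exp_deriv:
  assumes f: "exponential_bound f K R"
  shows "continuous_on UNIV (\<lambda>(s, z). exp_deriv N f s z)"
proof -
  have "isCont (\<lambda>(s, z). exp_deriv N f s z) (s0, z0)" for s0 z0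
  proof -
    \<comment> \<open>Uniform convergence is only local, so continuity is proved on an open bicylinder around each point.\<close>
    define A where "A = ball (0::complex) (cmod s0 + 1) \<times> ball (0::complex) (cmod z0 + 1)"
    have hol: "continuous_on UNIV ((deriv ^^ k) f)" for k
      using f entire_higher_deriv holomorphic_on_imp_continuous_on
      by (auto simp: exponential_bound_def)
    have "uniform_limit A (\<lambda>n (s, z). \<Sum>i<n. s ^ i / fact i * (deriv ^^ (N * i)) f z)
        (\<lambda>(s, z). \<Sum>i. s ^ i / fact i * (deriv ^^ (N * i)) f z) sequentially"
      unfolding case_prod_beta
      by (rule Weierstrass_m_test[OF _ summable_majorant], rule exp_deriv_term_bound[OF f, where S = "cmod s0 + 1" and r = "cmod z0 + 1"])
         (auto simp: A_def)
    moreover have "continuous_on A (\<lambda>(s, z). \<Sum>i<n. s ^ i / fact i * (deriv ^^ (N * i)) f z)" for n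
      unfolding case_prod_beta
      by (intro continuous_intros continuous_on_compose2[OF hol]) auto
    ultimately have "continuous_on A (\<lambda>(s, z). exp_deriv N f s z)"
      unfolding exp_deriv_def
      by (intro uniform_limit_theorem[where F=sequentially]) auto
    moreover have "open A" "(s0, z0) \<in> A"
      by (auto simp: A_def open_Times)
    ultimately show ?thesis
      by (simp add: continuous_on_eq_continuous_at)
  qed
  then show ?thesis
    by (auto simp: continuous_on_eq_continuous_at)
qed

lemma exp_deriv_has_field_derivative:
  assumes f: "exponential_bound f K R"
  shows "(exp_deriv N f s has_field_derivative exp_deriv N (deriv f) s z) (at z)"
proof -
  have hol: "f holomorphic_on UNIV" using f by (simp add: exponential_bound_def)
  have f': "exponential_bound (deriv f) (K * R) R"
    using exponential_bound_deriv[OF f, of 1] by simp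
  let ?f = "\<lambda>i z. s ^ i / fact i * (deriv ^^ (N * i)) f z"
  let ?f' = "\<lambda>i z. s ^ i / fact i * (deriv ^^ (N * i)) (deriv f) z"
  have d: "(?f i has_field_derivative ?f' i x) (at x)" for i x
  proof -
    have "((deriv ^^ (N * i)) f has_field_derivative (deriv ^^ Suc (N * i)) f x) (at x)"
      using entire_higher_deriv[OF hol, of "N * i"] by (simp add: holomorphic_derivI)
    then show ?thesis
      by (intro DERIV_cmult) (simp add: higher_deriv_higher_deriv[of _ 1, simplified])
  qed
  have "\<exists>g g'. \<forall>x\<in>UNIV. (\<lambda>n. ?f n x) sums g x \<and> (\<lambda>n. ?f' n x) sums g' x
      \<and> (g has_field_derivative g' x) (at x)"
  proof (rule series_and_derivative_comparison_complex)
    fix x :: complex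
    let ?h = "\<lambda>i. complex_of_real (K * exp (R * (cmod x + 1)) * ((cmod s * R ^ N) ^ i / fact i))"
    have "cmod (?f n y) \<le> cmod (?h n)" if "y \<in> ball x 1 \<inter> UNIV" for n y
    proof -
      have "cmod y \<le> cmod x + 1"
        using that norm_triangle_ineq2[of y x] by (auto simp: dist_norm norm_minus_commute)
      from exp_deriv_term_bound[OF f order_refl this] have
        "cmod (?f n y) \<le> K * exp (R * (cmod x + 1)) * ((cmod s * R ^ N) ^ n / fact n)" .
      then show ?thesis unfolding norm_of_real by linarith
    qed
    moreover have "summable ?h"
      by (intro summable_of_real summable_majorant)
    moreover have "range ?h \<subseteq> \<real>\<^sub>\<ge>\<^sub>0"
      using f by (auto simp: exponential_bound_def nonneg_Reals_of_real_iff simp del: of_real_mult of_real_divide)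
    ultimately show "\<exists>d h. 0 < d \<and> summable h \<and> range h \<subseteq> \<real>\<^sub>\<ge>\<^sub>0 \<and>
        (\<forall>\<^sub>F n in sequentially. \<forall>y\<in>ball x d \<inter> UNIV. cmod (?f n y) \<le> cmod (h n))"
      by (intro exI[of _ 1] exI[of _ ?h]) auto
  qed (use d in auto)
  then obtain g g' where g: "\<And>x. (\<lambda>n. ?f n x) sums g x" "\<And>x. (\<lambda>n. ?f' n x) sums g' x"
      "\<And>x. (g has_field_derivative g' x) (at x)" by auto
  have "g = exp_deriv N f s" "g' = exp_deriv N (deriv f) s"
    using g(1,2) exp_deriv_sums[OF f] exp_deriv_sums[OF f'] by (auto intro!: ext sums_unique2)
  with g(3) show ?thesis by simp
qed

lemma higher_deriv_exp_deriv:
  assumes f: "exponential_bound f K R"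
  shows "(deriv ^^ j) (exp_deriv N f s) = exp_deriv N ((deriv ^^ j) f) s"
proof (induction j)
  case (Suc j)
  have "deriv (exp_deriv N ((deriv ^^ j) f) s) z = exp_deriv N (deriv ((deriv ^^ j) f)) s z" for z
    by (rule DERIV_imp_deriv[OF exp_deriv_has_field_derivative[OF exponential_bound_deriv[OF f]]])
  then show ?case by (auto simp: Suc)
qed simp

text \<open>Differentiating \<open>s ^ i / i!\<close> shifts the series by one index, and each shift brings in one more
factor \<open>D ^ N\<close>.\<close>

lemma exp_deriv_has_time_derivative:
  assumes f: "exponential_bound f K R"
  shows "((\<lambda>s. exp_deriv N f s z) has_field_derivative exp_deriv N ((deriv ^^ N) f) s z) (at s)"
proof -
  let ?f = "\<lambda>i s. s ^ i / fact i * (deriv ^^ (N * i)) f z"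
  let ?f' = "\<lambda>i s. of_nat i * s ^ (i - 1) / fact i * (deriv ^^ (N * i)) f z"
  have "\<exists>g g'. \<forall>x\<in>UNIV. (\<lambda>n. ?f n x) sums g x \<and> (\<lambda>n. ?f' n x) sums g' x
      \<and> (g has_field_derivative g' x) (at x)"
  proof (rule series_and_derivative_comparison_complex)
    fix i :: nat and x :: complex
    show "(?f i has_field_derivative ?f' i x) (at x)"
      by (auto intro!: derivative_eq_intros)
  next
    fix x :: complex
    let ?h = "\<lambda>i. complex_of_real (K * exp (R * cmod z) * (((cmod x + 1) * R ^ N) ^ i / fact i))"
    have "cmod (?f n y) \<le> cmod (?h n)" if "y \<in> ball x 1 \<inter> UNIV" for n y
    proof -
      have "cmod y \<le> cmod x + 1"
        using that norm_triangle_ineq2[of y x] by (auto simp: dist_norm norm_minus_commute)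
      from exp_deriv_term_bound[OF f this order_refl] have
        "cmod (?f n y) \<le> K * exp (R * cmod z) * (((cmod x + 1) * R ^ N) ^ n / fact n)" .
      then show ?thesis unfolding norm_of_real by linarith
    qed
    moreover have "summable ?h"
      by (intro summable_of_real summable_majorant)
    moreover have "range ?h \<subseteq> \<real>\<^sub>\<ge>\<^sub>0"
      using f by (auto simp: exponential_bound_def nonneg_Reals_of_real_iff simp del: of_real_mult of_real_divide)
    ultimately show "\<exists>d h. 0 < d \<and> summable h \<and> range h \<subseteq> \<real>\<^sub>\<ge>\<^sub>0 \<and>
        (\<forall>\<^sub>F n in sequentially. \<forall>y\<in>ball x d \<inter> UNIV. cmod (?f n y) \<le> cmod (h n))"
      by (intro exI[of _ 1] exI[of _ ?h]) auto
  qed auto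
  then obtain g g' where g: "\<And>x. (\<lambda>n. ?f n x) sums g x" "\<And>x. (\<lambda>n. ?f' n x) sums g' x"
      "\<And>x. (g has_field_derivative g' x) (at x)" by auto
  have "g = (\<lambda>s. exp_deriv N f s z)"
    using g(1) exp_deriv_sums[OF f] by (auto intro!: ext sums_unique2)
  moreover have "g' s = exp_deriv N ((deriv ^^ N) f) s z"
  proof -
    have "(\<lambda>i. ?f' (Suc i) s) sums g' s"
      using g(2)[of s] sums_Suc_iff[of "\<lambda>i. ?f' i s" "g' s"] by simp
    moreover have "?f' (Suc i) s = s ^ i / fact i * (deriv ^^ (N * i)) ((deriv ^^ N) f) z" for i
      by (simp add: higher_deriv_higher_deriv add.commute divide_simps del: of_nat_Suc)
    ultimately have "(\<lambda>i. s ^ i / fact i * (deriv ^^ (N * i)) ((deriv ^^ N) f) z) sums g' s"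
      by (simp only:)
    then show ?thesis
      by (rule sums_unique2) (rule exp_deriv_sums[OF exponential_bound_deriv[OF f]])
  qed
  ultimately show ?thesis using g(3)[of s] by simp
qed

lemma exp_deriv_0: "exp_deriv N f 0 z = f z"
  unfolding exp_deriv_def by (subst suminf_finite[of "{0}"]) auto

lemma exp_deriv_has_vector_derivative:
  assumes "exponential_bound f K R"
  shows "((\<lambda>t. exp_deriv N f (of_real t * \<kappa>) z) has_vector_derivative
            \<kappa> * exp_deriv N ((deriv ^^ N) f) (of_real t * \<kappa>) z) (at t within S)"
proof -
  have "((\<lambda>w. exp_deriv N f (w * \<kappa>) z) has_field_derivative
      exp_deriv N ((deriv ^^ N) f) (of_real t * \<kappa>) z * \<kappa>) (at (of_real t))"
    by (rule DERIV_chain2[OF exp_deriv_has_time_derivative[OF assms]])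
       (auto intro!: derivative_eq_intros)
  then show ?thesis
    by (subst mult.commute) (rule has_vector_derivative_real_field)
qed

lemma exp_deriv_classical_solution:
  assumes g: "exponential_bound g K R"
    and u: "\<And>t. t \<ge> 0 \<Longrightarrow> u t = exp_deriv N g (of_real t * (\<alpha> / fact N))"
  shows "classical_solution N \<alpha> g u"
  unfolding classical_solution_def
proof (intro conjI allI impI)
  fix t :: real assume t: "t \<ge> 0"
  show "u t holomorphic_on UNIV"
    unfolding u[OF t] holomorphic_on_def field_differentiable_def
    using exp_deriv_has_field_derivative[OF g] by auto
next
  fix j
  have "continuous_on ({0..} \<times> UNIV)
      (\<lambda>tz. case_prod (exp_deriv N ((deriv ^^ j) g)) (of_real (fst tz) * (\<alpha> / fact N), snd tz))"
    by (rule continuous_on_compose2[OF continuous_on_exp_deriv[OF exponential_bound_deriv[OF g]]])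
       (auto intro!: continuous_intros)
  then show "continuous_on ({0..} \<times> UNIV) (\<lambda>(t, z). (deriv ^^ j) (u t) z)"
    by (rule continuous_on_eq) (auto simp: u higher_deriv_exp_deriv[OF g])
next
  fix t :: real and z assume t: "t \<ge> 0"
  show "((\<lambda>s. u s z) has_vector_derivative \<alpha> / fact N * (deriv ^^ N) (u t) z) (at t within {0..})"
    unfolding u[OF t] higher_deriv_exp_deriv[OF g]
    by (rule has_vector_derivative_transform[OF _ _ exp_deriv_has_vector_derivative[OF g]])
       (use t u in auto)
next
  fix z show "u 0 z = g z" by (simp add: u exp_deriv_0)
qed

text \<open>
The fundamental theorem of calculus in the time variable. The factor \<open>\<alpha> / N!\<close> stays inside until
the integral has been evaluated, since for \<open>\<alpha> = 0\<close> it cannot be divided out.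
\<close>

lemma exp_deriv_integrated_equation:
  assumes g: "exponential_bound g K R"
    and u: "\<And>t z. t \<ge> 0 \<Longrightarrow> u t z = exp_deriv N g (of_real t * (\<alpha> / fact N)) z"
    and v: "\<And>t z. t \<ge> 0 \<Longrightarrow> v t z = exp_deriv N ((deriv ^^ N) g) (of_real t * (\<alpha> / fact N)) z"
  shows "integrated_equation N \<alpha> g u v"
  unfolding integrated_equation_def
proof (intro allI impI conjI)
  fix t :: real and z assume t: "t \<ge> 0"
  have "continuous_on {0..t} (\<lambda>s. case_prod (exp_deriv N ((deriv ^^ N) g)) (of_real s * (\<alpha> / fact N), z))"
    by (rule continuous_on_compose2[OF continuous_on_exp_deriv[OF exponential_bound_deriv[OF g]]])
       (auto intro!: continuous_intros)
  then have v_cont: "continuous_on {0..t} (\<lambda>s. v s z)"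
    by (rule continuous_on_eq) (auto simp: v)
  then show "set_integrable lborel {0..t} (\<lambda>s. v s z)"
    unfolding set_integrable_def by (intro borel_integrable_compact) auto
  have "(LBINT s. indicat_real {0..t} s *\<^sub>R (\<alpha> / fact N * v s z)) = u t z - u 0 z"
  proof (rule integral_FTC_Icc[OF t])
    fix s assume s: "0 \<le> s" "s \<le> t"
    show "((\<lambda>s. u s z) has_vector_derivative \<alpha> / fact N * v s z) (at s within {0..t})"
      unfolding v[OF s(1)]
      by (rule has_vector_derivative_transform[OF _ _ exp_deriv_has_vector_derivative[OF g]])
         (use s u in auto)
  qed (intro continuous_intros v_cont)
  moreover have "u 0 z = g z" by (simp add: u exp_deriv_0)
  moreover have "(LBINT s. indicat_real {0..t} s *\<^sub>R (\<alpha> / fact N * v s z))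
      = \<alpha> / fact N * (LINT s:{0..t}|lborel. v s z)"
    unfolding set_lebesgue_integral_def
    by (subst integral_mult_right_zero[symmetric]) (simp add: mult.commute scaleR_conv_of_real mult.assoc)
  ultimately show "u t z - g z = \<alpha> / fact N * (LINT s:{0..t}|lborel. v s z)" by simp
qed

section \<open>Powers of perturbed factors\<close>

text \<open>Telescoping. In contrast to the usual statement on the unit disc, the factors may exceed \<open>1\<close> in norm.
This is needed for factors of size \<open>1 + O(1/n)\<close>, whose \<open>n\<close>-th powers stay bounded.\<close>

lemma norm_power_diff_le:
  fixes A B :: complex
  assumes "cmod A \<le> q" "cmod B \<le> q" "1 \<le> q"
  shows "cmod (A ^ m - B ^ m) \<le> real m * q ^ m * cmod (A - B)"
proof (induction m)
  case (Suc m)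
  have "A ^ Suc m - B ^ Suc m = A * (A ^ m - B ^ m) + (A - B) * B ^ m"
    by (simp add: algebra_simps)
  then have "cmod (A ^ Suc m - B ^ Suc m) \<le> cmod A * cmod (A ^ m - B ^ m) + cmod (A - B) * cmod B ^ m"
    by (metis norm_mult norm_power norm_triangle_ineq)
  also have "\<dots> \<le> q * (real m * q ^ m * cmod (A - B)) + cmod (A - B) * q ^ Suc m"
  proof (intro add_mono mult_mono Suc)
    have "cmod B ^ m \<le> q ^ m" using assms by (intro power_mono) auto
    also have "\<dots> \<le> q ^ Suc m" using assms by (intro power_increasing) auto
    finally show "cmod B ^ m \<le> q ^ Suc m" .
  qed (use assms in auto)
  also have "\<dots> = real (Suc m) * q ^ Suc m * cmod (A - B)"
    by (simp add: algebra_simps)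
  finally show ?case .
qed simp

lemma norm_exp_minus_1_le: "cmod (exp w - 1) \<le> cmod w * exp (cmod w)"
proof -
  have "cmod (exp w - 1) \<le> exp \<bar>Re w\<bar> * cmod w"
    using Taylor_exp[of w 0] by simp
  also have "\<dots> \<le> exp (cmod w) * cmod w"
    using abs_Re_le_cmod by (intro mult_right_mono) auto
  finally show ?thesis by (simp add: mult.commute)
qed

lemma norm_exp_minus_linear_le: "cmod (exp w - 1 - w) \<le> (cmod w)\<^sup>2 * exp (cmod w)"
proof -
  have "cmod (exp w - 1 - w) \<le> exp \<bar>Re w\<bar> * (cmod w)\<^sup>2"
    using Taylor_exp[of w 1] by (simp add: diff_diff_eq power2_eq_square)
  also have "\<dots> \<le> exp (cmod w) * (cmod w)\<^sup>2"
    using abs_Re_le_cmod by (intro mult_right_mono) auto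
  finally show ?thesis by (simp add: mult.commute)
qed

lemma perturbed_factor_bound:
  fixes A p :: complex
  assumes p: "cmod p \<le> P" and n: "n \<ge> 1"
    and A: "cmod (A - 1 - p / of_nat n) \<le> K / (real n)\<^sup>2"
  shows "cmod A \<le> exp ((P + K) / real n)"
proof -
  have K: "0 \<le> K"
    using order_trans[OF norm_ge_zero A] n by (simp add: zero_le_divide_iff)
  have "cmod A \<le> cmod (A - 1 - p / of_nat n) + cmod (1 + p / of_nat n)"
    using norm_triangle_ineq[of "A - 1 - p / of_nat n" "1 + p / of_nat n"]
    by (simp add: algebra_simps)
  also have "\<dots> \<le> K / (real n)\<^sup>2 + (1 + cmod p / real n)"
    using A norm_triangle_ineq[of 1 "p / of_nat n"] by (intro add_mono) (auto simp: norm_divide)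
  also have "\<dots> \<le> K / real n + (1 + P / real n)"
    using n p K by (intro add_mono divide_right_mono divide_left_mono) (auto simp: power2_eq_square)
  also have "\<dots> = 1 + (P + K) / real n" by (simp add: add_divide_distrib)
  also have "\<dots> \<le> exp ((P + K) / real n)" by (rule exp_ge_add_one_self)
  finally show ?thesis .
qed

lemma exp_power_floor_le:
  assumes "0 \<le> t" "0 \<le> C" "n \<ge> 1"
  shows "exp (C / real n) ^ nat \<lfloor>real n * t\<rfloor> \<le> exp (C * t)"
proof -
  have "real (nat \<lfloor>real n * t\<rfloor>) \<le> real n * t"
    using assms by (simp add: of_nat_floor)
  then have "real (nat \<lfloor>real n * t\<rfloor>) * (C / real n) \<le> (real n * t) * (C / real n)"
    using assms by (intro mult_right_mono) auto
  also have "\<dots> = C * t" using assms by simp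
  finally show ?thesis by (simp add: exp_of_nat_mult[symmetric])
qed

text \<open>The compound interest limit \<open>(1 + p / n + O(1 / n\<^sup>2)) ^ \<lfloor>n * t\<rfloor> \<rightarrow> exp (t * p)\<close>, uniformly where \<open>p\<close> and
the error constant are bounded. Each factor differs from \<open>exp (p / n)\<close> by \<open>O(1 / n\<^sup>2)\<close>, so the
powers differ by \<open>O(1 / n)\<close>; replacing \<open>\<lfloor>n * t\<rfloor> / n\<close> by \<open>t\<close> costs \<open>O(1 / n)\<close> more.\<close>

lemma compound_power_uniform_limit:
  fixes F :: "nat \<Rightarrow> 'x \<Rightarrow> complex"
  assumes t: "0 \<le> t"
    and p: "\<And>x. x \<in> X \<Longrightarrow> cmod (p x) \<le> P"
    and F: "\<And>n x. n \<ge> 1 \<Longrightarrow> x \<in> X \<Longrightarrow> cmod (F n x - 1 - p x / of_nat n) \<le> K / (real n)\<^sup>2"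
  shows "uniform_limit X (\<lambda>n x. F n x ^ nat \<lfloor>real n * t\<rfloor>) (\<lambda>x. exp (of_real t * p x)) sequentially"
proof (cases "X = {}")
  case False
  then obtain x0 where "x0 \<in> X" by blast
  then have P: "0 \<le> P" and K: "0 \<le> K"
    using order_trans[OF norm_ge_zero p] order_trans[OF norm_ge_zero F[of 1]] by auto
  \<comment> \<open>The first summand collects the error of the factors, the second the error of rounding \<open>n * t\<close> down.\<close>
  define L where "L = t * exp ((P + K) * t) * (K + P\<^sup>2 * exp P) + exp (P * t) * (P * exp P)"
  have bound: "cmod (F n x ^ nat \<lfloor>real n * t\<rfloor> - exp (of_real t * p x)) \<le> L / real n"
    if n: "n \<ge> 1" and x: "x \<in> X" for n x
  proof -
    define m where "m = nat \<lfloor>real n * t\<rfloor>"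
    define q where "q = exp ((P + K) / real n)"
    define E where "E = exp (p x / of_nat n)"
    have m: "real m \<le> real n * t" "real n * t \<le> real m + 1"
      using t by (auto simp: m_def of_nat_floor)
    have w: "cmod (p x / of_nat n) \<le> P / real n" "P / real n \<le> P"
      using p[OF x] n P by (auto simp: norm_divide divide_right_mono field_simps mult_le_cancel_left1)
    have "P / real n \<le> (P + K) / real n" using K by (intro divide_right_mono) auto
    then have "cmod E \<le> q"
      unfolding E_def q_def using w(1) by (intro order_trans[OF norm_exp]) auto
    moreover have "cmod (F n x) \<le> q"
      unfolding q_def by (rule perturbed_factor_bound[OF p[OF x] n F[OF n x]])
    moreover have "1 \<le> q" using P K by (simp add: q_def)
    ultimately have "cmod (F n x ^ m - E ^ m) \<le> real m * q ^ m * cmod (F n x - E)"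
      by (intro norm_power_diff_le)
    also have "\<dots> \<le> (real n * t) * exp ((P + K) * t) * ((K + P\<^sup>2 * exp P) / (real n)\<^sup>2)"
    proof (intro mult_mono m)
      show "q ^ m \<le> exp ((P + K) * t)"
        unfolding q_def m_def using P K t n by (intro exp_power_floor_le) auto
      have "cmod (E - 1 - p x / of_nat n) \<le> (cmod (p x / of_nat n))\<^sup>2 * exp (cmod (p x / of_nat n))"
        unfolding E_def by (rule norm_exp_minus_linear_le)
      also have "\<dots> \<le> (P / real n)\<^sup>2 * exp P"
        using w P by (intro mult_mono power_mono) auto
      finally have "cmod (E - 1 - p x / of_nat n) \<le> P\<^sup>2 * exp P / (real n)\<^sup>2"
        by (simp add: power_divide)
      then show "cmod (F n x - E) \<le> (K + P\<^sup>2 * exp P) / (real n)\<^sup>2"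
        using F[OF n x] norm_triangle_ineq4[of "F n x - 1 - p x / of_nat n" "E - 1 - p x / of_nat n"]
        by (simp add: add_divide_distrib)
    qed (use t P K in \<open>auto simp: q_def\<close>)
    also have "\<dots> = t * exp ((P + K) * t) * (K + P\<^sup>2 * exp P) / real n"
      using n by (simp add: power2_eq_square)
    finally have 1: "cmod (F n x ^ m - E ^ m) \<le> t * exp ((P + K) * t) * (K + P\<^sup>2 * exp P) / real n" .
    define v where "v = of_real (real m / real n - t) * p x"
    have "E ^ m = exp (of_real t * p x) * exp v"
    proof -
      have "of_nat m * (p x / of_nat n) = of_real t * p x + v"
        unfolding v_def by (simp add: algebra_simps)
      then show ?thesis
        by (simp add: E_def exp_of_nat_mult[symmetric] exp_add[symmetric])
    qed
    then have "E ^ m - exp (of_real t * p x) = exp (of_real t * p x) * (exp v - 1)"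
      by (simp add: algebra_simps)
    then have "cmod (E ^ m - exp (of_real t * p x)) = cmod (exp (of_real t * p x)) * cmod (exp v - 1)"
      by (simp add: norm_mult)
    also have "\<dots> \<le> exp (P * t) * (P / real n * exp P)"
    proof (rule mult_mono)
      show "cmod (exp (of_real t * p x)) \<le> exp (P * t)"
        using mult_right_mono[OF p[OF x] t] t
        by (intro order_trans[OF norm_exp]) (simp add: norm_mult mult.commute)
      have "\<bar>real m / real n - t\<bar> \<le> 1 / real n"
      proof -
        have "real m / real n - t = (real m - real n * t) / real n"
          using n by (simp add: diff_divide_distrib)
        moreover have "\<bar>real m - real n * t\<bar> \<le> 1" using m by simp
        ultimately show ?thesis using n by (simp add: divide_right_mono)
      qed
      then have "cmod v \<le> 1 / real n * P"
        unfolding v_def norm_mult norm_of_real using p[OF x] by (intro mult_mono) auto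
      then have "cmod v \<le> P / real n" by simp
      then show "cmod (exp v - 1) \<le> P / real n * exp P"
        using w(2) P by (intro order_trans[OF norm_exp_minus_1_le] mult_mono) auto
    qed auto
    finally have "cmod (E ^ m - exp (of_real t * p x)) \<le> exp (P * t) * (P * exp P) / real n"
      by simp
    then show ?thesis
      using 1 norm_triangle_ineq[of "F n x ^ m - E ^ m" "E ^ m - exp (of_real t * p x)"]
      by (simp add: L_def m_def add_divide_distrib)
  qed
  show ?thesis
  proof (rule uniform_limitI)
    fix e :: real assume "e > 0"
    have "(\<lambda>n. L / real n) \<longlonglongrightarrow> 0" by (rule lim_const_over_n)
    then have "eventually (\<lambda>n. L / real n < e) sequentially"
      using \<open>e > 0\<close> by (rule order_tendstoD)
    then show "\<forall>\<^sub>F n in sequentially. \<forall>x\<in>X.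
        dist (F n x ^ nat \<lfloor>real n * t\<rfloor>) (exp (of_real t * p x)) < e"
      using eventually_ge_at_top[of 1]
      by eventually_elim (auto simp: dist_norm intro: le_less_trans[OF bound])
  qed
qed simp

section \<open>The transform of a single step\<close>

text \<open>The expectation of \<open>exp (y * \<xi>)\<close> for a step \<open>\<xi>\<close> that is uniform on the \<open>N\<close>-th roots of unity,
multiplied by \<open>a\<close>.\<close>

definition step_transform :: "nat \<Rightarrow> complex \<Rightarrow> complex \<Rightarrow> complex" where
  "step_transform N a y =
     (\<Sum>k<N. exp (y * (a * exp (2 * of_real pi * \<i> * of_nat k / of_nat N)))) / of_nat N"

lemma sum_powers_roots_of_unity:
  assumes "N \<ge> 1"
  shows "(\<Sum>k<N. exp (2 * complex_of_real pi * \<i> * of_nat k / of_nat N) ^ i)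
       = (if N dvd i then of_nat N else 0)"
proof -
  define q where "q = exp (2 * complex_of_real pi * \<i> * of_nat i / of_nat N)"
  have "exp (2 * complex_of_real pi * \<i> * of_nat k / of_nat N) ^ i = q ^ k" for k
    unfolding q_def by (simp add: exp_of_nat_mult[symmetric] mult_ac)
  moreover have "q = 1 \<longleftrightarrow> N dvd i"
    unfolding q_def by (rule complex_root_unity_eq_1[OF assms])
  moreover have "q ^ N = 1"
  proof -
    have "q ^ N = exp (2 * complex_of_real pi * \<i>) ^ i"
      using assms unfolding q_def by (simp add: exp_of_nat_mult[symmetric] mult_ac)
    then show ?thesis by simp
  qed
  ultimately show ?thesis by (auto simp: geometric_sum)
qed

text \<open>Averaging over the roots of unity keeps only the Taylor terms of the exponential whose index is a
multiple of \<open>N\<close>. Below degree \<open>2 * N\<close> these are the indices \<open>0\<close> and \<open>N\<close>.\<close>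

lemma step_transform_expansion:
  assumes N: "N \<ge> 1"
  shows "cmod (step_transform N a y - 1 - a ^ N * y ^ N / fact N)
       \<le> exp (cmod (y * a)) * cmod (y * a) ^ (2 * N)"
proof -
  define \<omega> where "\<omega> k = exp (2 * complex_of_real pi * \<i> * of_nat k / of_nat N)" for k
  define T where "T z = (\<Sum>i\<le>2*N-1. z ^ i / fact i)" for z :: complex
  have \<omega>: "cmod (\<omega> k) = 1" for k
    by (simp add: \<omega>_def)
  have "(\<Sum>k<N. T (y * (a * \<omega> k))) = (\<Sum>i\<le>2*N-1. \<Sum>k<N. (y * a) ^ i / fact i * \<omega> k ^ i)"
    unfolding T_def by (subst sum.swap) (simp add: power_mult_distrib mult_ac)
  also have "\<dots> = (\<Sum>i\<le>2*N-1. if N dvd i then (y * a) ^ i / fact i * of_nat N else 0)"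
  proof (rule sum.cong[OF refl])
    fix i
    have "(\<Sum>k<N. (y * a) ^ i / fact i * \<omega> k ^ i) = (y * a) ^ i / fact i * (\<Sum>k<N. \<omega> k ^ i)"
      by (rule sum_distrib_left[symmetric])
    then show "(\<Sum>k<N. (y * a) ^ i / fact i * \<omega> k ^ i)
        = (if N dvd i then (y * a) ^ i / fact i * of_nat N else 0)"
      unfolding \<omega>_def sum_powers_roots_of_unity[OF N] by simp
  qed
  also have "\<dots> = (\<Sum>i\<in>{0, N}. (y * a) ^ i / fact i * of_nat N)"
  proof (rule sum.mono_neutral_cong_right)
    show "\<forall>i\<in>{..2*N-1} - {0, N}. (if N dvd i then (y * a) ^ i / fact i * of_nat N else 0) = 0"
    proof
      fix i assume i: "i \<in> {..2*N-1} - {0, N}"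
      have "\<not> N dvd i"
      proof
        assume "N dvd i"
        then obtain j where j: "i = N * j" by blast
        with i have "j \<noteq> 0" "j \<noteq> 1" by auto
        then have "N * 2 \<le> N * j" by (intro mult_le_mono2) auto
        moreover have "i \<le> 2 * N - 1" using i by simp
        ultimately show False using j N by linarith
      qed
      then show "(if N dvd i then (y * a) ^ i / fact i * of_nat N else 0) = 0" by simp
    qed
  qed (use N in auto)
  also have "\<dots> = of_nat N * (1 + (y * a) ^ N / fact N)"
    using N by (simp add: algebra_simps)
  finally have avg: "1 + a ^ N * y ^ N / fact N = (\<Sum>k<N. T (y * (a * \<omega> k))) / of_nat N"
    using N by (simp add: power_mult_distrib mult.commute)
  have "step_transform N a y - 1 - a ^ N * y ^ N / fact N
      = (\<Sum>k<N. exp (y * (a * \<omega> k)) - T (y * (a * \<omega> k))) / of_nat N"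
    unfolding diff_diff_eq avg step_transform_def \<omega>_def[symmetric]
    by (simp add: sum_subtractf diff_divide_distrib)
  also have "cmod \<dots> \<le> (\<Sum>k<N. cmod (exp (y * (a * \<omega> k)) - T (y * (a * \<omega> k)))) / real N"
    by (simp add: norm_divide divide_right_mono norm_sum)
  also have "\<dots> \<le> (\<Sum>k<N. exp (cmod (y * a)) * cmod (y * a) ^ (2 * N)) / real N"
  proof (intro divide_right_mono sum_mono)
    fix k
    let ?z = "y * (a * \<omega> k)"
    have "cmod (exp ?z - T ?z) \<le> exp \<bar>Re ?z\<bar> * cmod ?z ^ (2 * N) / fact (2 * N - 1)"
      unfolding T_def using Taylor_exp[of ?z "2 * N - 1"] N by simp
    also have "\<dots> \<le> exp \<bar>Re ?z\<bar> * cmod ?z ^ (2 * N) / 1"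
      by (intro divide_left_mono) auto
    also have "\<dots> \<le> exp (cmod ?z) * cmod ?z ^ (2 * N)"
      using abs_Re_le_cmod[of ?z] by (simp add: mult_right_mono)
    finally show "cmod (exp ?z - T ?z) \<le> exp (cmod (y * a)) * cmod (y * a) ^ (2 * N)"
      using \<omega>[of k] by (simp add: norm_mult)
  qed auto
  also have "\<dots> = exp (cmod (y * a)) * cmod (y * a) ^ (2 * N)" using N by simp
  finally show ?thesis .
qed

text \<open>The exponent \<open>- 1 / N\<close> is the one that turns \<open>y ^ N\<close> into \<open>x ^ N / n\<close>; the remainder of order
\<open>y ^ (2 * N)\<close> then has size \<open>1 / n\<^sup>2\<close>, as the compound interest limit requires.\<close>

lemma scaled_step_transform_expansion:
  assumes N: "N \<ge> 1" and n: "n \<ge> 1" and x: "cmod x \<le> R"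
  shows "cmod (step_transform N a (x * of_real (real n powr (- 1 / real N))) - 1
             - (a ^ N * x ^ N / fact N) / of_nat n)
       \<le> exp (R * cmod a) * (R * cmod a) ^ (2 * N) / (real n)\<^sup>2"
proof -
  define r where "r = real n powr (- 1 / real N)"
  have r: "0 \<le> r" "r \<le> 1"
    using n powr_mono[of "- 1 / real N" 0 "real n"] by (auto simp: r_def)
  have rN: "r ^ N = 1 / real n"
  proof -
    have "r ^ N = real n powr (- 1 / real N * real N)"
      unfolding r_def using n by (simp add: powr_realpow[symmetric] powr_powr)
    then show ?thesis using N n by (simp add: powr_minus_divide)
  qed
  have r2N: "r ^ (2 * N) = 1 / (real n)\<^sup>2"
    by (simp add: power_mult mult.commute[of 2] rN power_divide)
  have R: "0 \<le> R" using x norm_ge_zero[of x] by linarith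
  have c: "cmod (x * of_real r * a) = r * (cmod x * cmod a)" using r by (simp add: norm_mult)
  have le: "cmod x * cmod a \<le> R * cmod a" using x by (simp add: mult_right_mono)
  have "a ^ N * (x * of_real r) ^ N / fact N = (a ^ N * x ^ N / fact N) / of_nat n"
    using rN by (simp add: power_mult_distrib of_real_power[symmetric] del: of_real_power)
  then have "cmod (step_transform N a (x * of_real r) - 1 - (a ^ N * x ^ N / fact N) / of_nat n)
      \<le> exp (r * (cmod x * cmod a)) * (r * (cmod x * cmod a)) ^ (2 * N)"
    using step_transform_expansion[OF N, of a "x * of_real r"] by (simp only: c)
  also have "\<dots> \<le> exp (R * cmod a) * (r ^ (2 * N) * (R * cmod a) ^ (2 * N))"
    unfolding power_mult_distrib[of r]
  proof (intro mult_mono power_mono)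
    show "exp (r * (cmod x * cmod a)) \<le> exp (R * cmod a)"
      using r le mult_left_le_one_le[of "cmod x * cmod a" r] by auto
  qed (use r le R x in auto)
  finally show ?thesis unfolding r_def[symmetric] by (simp add: r2N)
qed

lemma power_series_coefficient:
  fixes c :: "nat \<Rightarrow> complex"
  assumes "\<And>x. (\<lambda>k. c k * x ^ k) sums F x"
  shows "(deriv ^^ k) F 0 / fact k = c k"
proof -
  have "conv_radius c = \<infinity>"
    using assms by (intro conv_radius_inftyI'') (auto simp: sums_iff)
  then have "F has_fps_expansion Abs_fps c"
    using assms by (auto simp: has_fps_expansion_def fps_conv_radius_def eval_fps_def sums_iff)
  from fps_nth_fps_expansion[OF this] show ?thesis by simp
qed

lemma exp_monomial_sums:
  assumes "N \<ge> 1"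
  shows "(\<lambda>k. (if N dvd k then \<tau> ^ (k div N) / fact (k div N) else 0) * x ^ k) sums exp (\<tau> * x ^ N :: complex)"
proof -
  let ?f = "\<lambda>k. (if N dvd k then \<tau> ^ (k div N) / fact (k div N) else 0) * x ^ k"
  have "(\<lambda>i. ?f (N * i)) sums exp (\<tau> * x ^ N)"
    using exp_converges[of "\<tau> * x ^ N"] assms
    by (simp add: scaleR_conv_of_real power_mult_distrib power_mult[symmetric] field_simps)
  moreover have "strict_mono (\<lambda>i. N * i)" using assms by (simp add: strict_mono_def)
  moreover have "?f k = 0" if "k \<notin> range (\<lambda>i. N * i)" for k using that by auto
  ultimately show ?thesis by (rule iffD1[OF sums_mono_reindex, rotated 2])
qed

lemma scaled_roots_nonempty_finite: "N \<ge> 1 \<Longrightarrow> scaled_roots N a \<noteq> {}" "finite (scaled_roots N a)"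
  by (auto simp: scaled_roots_def)

text \<open>For \<open>a = 0\<close> the set of scaled roots collapses to a single point, but the average over \<open>N\<close> indices
still gives the right value.\<close>

lemma integral_uniform_scaled_roots:
  fixes f :: "complex \<Rightarrow> complex"
  assumes N: "N \<ge> 1" and [measurable]: "f \<in> borel_measurable borel"
  shows "integral\<^sup>L (uniform_scaled_roots N a) f
       = (\<Sum>k<N. f (a * exp (2 * of_real pi * \<i> * of_nat k / of_nat N))) / of_nat N"
proof -
  let ?\<omega> = "\<lambda>k. exp (2 * complex_of_real pi * \<i> * of_nat k / of_nat N)"
  have "integral\<^sup>L (uniform_scaled_roots N a) f = (\<integral>x. f x \<partial>measure_pmf (pmf_of_set (scaled_roots N a)))"
    unfolding uniform_scaled_roots_def by (subst integral_distr) auto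
  also have "\<dots> = (\<Sum>x\<in>scaled_roots N a. pmf (pmf_of_set (scaled_roots N a)) x *\<^sub>R f x)"
    using N scaled_roots_nonempty_finite
    by (intro integral_measure_pmf) (auto simp: set_pmf_of_set)
  also have "\<dots> = (\<Sum>x\<in>scaled_roots N a. f x) / of_nat (card (scaled_roots N a))"
    using N scaled_roots_nonempty_finite
    by (simp add: pmf_of_set scaleR_conv_of_real sum_divide_distrib)
  also have "\<dots> = (\<Sum>k<N. f (a * ?\<omega> k)) / of_nat N"
  proof (cases "a = 0")
    case True
    then have "scaled_roots N a = {0}" using N by (auto simp: scaled_roots_def image_constant_conv)
    then show ?thesis using N True by simp
  next
    case False
    have inj: "inj_on (\<lambda>k. a * ?\<omega> k) {0..<N}"
      using N False complex_root_unity_eq[of N] by (auto simp: inj_on_def)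
    show ?thesis
      unfolding scaled_roots_def
      by (simp add: sum.reindex[OF inj] card_image[OF inj] lessThan_atLeast0)
  qed
  finally show ?thesis .
qed

lemma AE_uniform_scaled_roots:
  assumes "N \<ge> 1"
  shows "AE x in uniform_scaled_roots N a. cmod x \<le> cmod a"
proof -
  have "\<forall>x\<in>scaled_roots N a. cmod x \<le> cmod a"
    by (auto simp: scaled_roots_def norm_mult)
  then show ?thesis
    unfolding uniform_scaled_roots_def
    using assms scaled_roots_nonempty_finite
    by (subst AE_distr_iff) (auto simp: AE_measure_pmf_iff set_pmf_of_set)
qed

section \<open>Moments and limits of the walk\<close>

text \<open>An everywhere convergent power series converges absolutely at the almost sure bound of \<open>W\<close>, and this
dominates the series in the expectation. It is used twice: for exponentials, to recognise the moments
as Taylor coefficients, and for the entire function under study.\<close>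

lemma (in prob_space) expectation_power_series:
  fixes W :: "'a \<Rightarrow> complex" and c :: "nat \<Rightarrow> complex"
  assumes W[measurable]: "W \<in> borel_measurable M" and bound: "AE \<omega> in M. cmod (W \<omega>) \<le> L"
    and sums: "\<And>w. (\<lambda>k. c k * w ^ k) sums f w"
  shows "integrable M (\<lambda>\<omega>. f (W \<omega>))"
    and "(\<lambda>k. c k * (\<integral>\<omega>. W \<omega> ^ k \<partial>M)) sums (\<integral>\<omega>. f (W \<omega>) \<partial>M)"
proof -
  define B where "B k = cmod (c k * complex_of_real \<bar>L\<bar> ^ k)" for k
  have B: "summable B"
    unfolding B_def
    by (rule powser_insidea[OF sums_summable[OF sums[of "complex_of_real (\<bar>L\<bar> + 1)"]]]) simp
  have le: "cmod (c k * W \<omega> ^ k) \<le> B k" if "cmod (W \<omega>) \<le> L" for k \<omega>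
    using that by (auto simp: B_def norm_mult norm_power intro!: mult_left_mono power_mono)
  have int: "integrable M (\<lambda>\<omega>. c k * W \<omega> ^ k)" for k
    using bound by (intro integrable_const_bound[of _ "B k"]) (auto elim!: eventually_mono intro: le)
  have AE_summable: "AE \<omega> in M. summable (\<lambda>k. norm (c k * W \<omega> ^ k))"
    using bound by eventually_elim (rule summable_comparison_test'[OF B, of 0], auto intro: le)
  have int_summable: "summable (\<lambda>k. \<integral>\<omega>. norm (c k * W \<omega> ^ k) \<partial>M)"
  proof (rule summable_comparison_test'[OF B, of 0])
    fix k
    have "(\<integral>\<omega>. norm (c k * W \<omega> ^ k) \<partial>M) \<le> B k"
      using bound by (intro integral_le_const integrable_norm int) (auto elim!: eventually_mono intro: le)
    then show "norm (\<integral>\<omega>. norm (c k * W \<omega> ^ k) \<partial>M) \<le> B k"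
      by simp
  qed
  have f: "(\<lambda>\<omega>. \<Sum>k. c k * W \<omega> ^ k) = (\<lambda>\<omega>. f (W \<omega>))"
    using sums by (auto simp: sums_iff)
  show "integrable M (\<lambda>\<omega>. f (W \<omega>))"
    using integrable_suminf[OF int AE_summable int_summable] by (simp only: f)
  show "(\<lambda>k. c k * (\<integral>\<omega>. W \<omega> ^ k \<partial>M)) sums (\<integral>\<omega>. f (W \<omega>) \<partial>M)"
    using sums_integral[OF int AE_summable int_summable] by (simp add: f)
qed

locale roots_of_unity_walk = prob_space M for M :: "'a measure" +
  fixes \<xi> :: "nat \<Rightarrow> 'a \<Rightarrow> complex" and N :: nat and a :: complex
  assumes N: "N \<ge> 1"
    and indep: "indep_vars (\<lambda>_. borel) \<xi> {1..}"
    and law: "\<And>k. k \<ge> 1 \<Longrightarrow> distr M borel (\<xi> k) = uniform_scaled_roots N a"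
begin

lemma measurable_step: "k \<ge> 1 \<Longrightarrow> \<xi> k \<in> borel_measurable M"
  using indep by (auto simp: indep_vars_def)

lemma step_bound:
  assumes "k \<ge> 1"
  shows "AE \<omega> in M. cmod (\<xi> k \<omega>) \<le> cmod a"
proof -
  have "AE x in distr M borel (\<xi> k). cmod x \<le> cmod a"
    unfolding law[OF assms] by (rule AE_uniform_scaled_roots[OF N])
  then show ?thesis
    using measurable_step[OF assms] by (subst (asm) AE_distr_iff) auto
qed

lemma measurable_walk: "scaled_walk N \<xi> n t \<in> borel_measurable M"
  unfolding scaled_walk_def
  by (intro borel_measurable_times borel_measurable_sum borel_measurable_const measurable_step) auto

lemma walk_bound:
  "AE \<omega> in M. cmod (scaled_walk N \<xi> n t \<omega>)
     \<le> real n powr (- 1 / real N) * (real (nat \<lfloor>real n * t\<rfloor>) * cmod a)"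
proof -
  have "AE \<omega> in M. \<forall>k\<in>{1..nat \<lfloor>real n * t\<rfloor>}. cmod (\<xi> k \<omega>) \<le> cmod a"
    by (intro AE_finite_allI step_bound) auto
  then show ?thesis
  proof eventually_elim
    case (elim \<omega>)
    have "cmod (\<Sum>k = 1..nat \<lfloor>real n * t\<rfloor>. \<xi> k \<omega>) \<le> real (nat \<lfloor>real n * t\<rfloor>) * cmod a"
      using sum_norm_bound[of "{1..nat \<lfloor>real n * t\<rfloor>}" "\<lambda>k. \<xi> k \<omega>" "cmod a"] elim by simp
    then show ?case
      unfolding scaled_walk_def norm_mult norm_of_real by (intro mult_mono) auto
  qed
qed

text \<open>
The exponential turns the sum of the steps into a product, and independence factors its expectation.
\<close>

lemma expectation_exp_walk:
  "(\<integral>\<omega>. exp (x * scaled_walk N \<xi> n t \<omega>) \<partial>M)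
   = step_transform N a (x * of_real (real n powr (- 1 / real N))) ^ nat \<lfloor>real n * t\<rfloor>"
proof -
  define y where "y = x * of_real (real n powr (- 1 / real N))"
  define I where "I = {1..nat \<lfloor>real n * t\<rfloor>}"
  have I: "finite I" "\<And>k. k \<in> I \<Longrightarrow> k \<ge> 1" "card I = nat \<lfloor>real n * t\<rfloor>" by (auto simp: I_def)
  have [measurable]: "(\<lambda>z. exp (y * z)) \<in> borel_measurable borel"
    by (intro borel_measurable_continuous_onI continuous_intros)
  have "indep_vars (\<lambda>_. borel) \<xi> I"
    using indep by (rule indep_vars_subset) (auto simp: I_def)
  then have ind: "indep_vars (\<lambda>_. borel) (\<lambda>k \<omega>. exp (y * \<xi> k \<omega>)) I"
    by (rule indep_vars_compose2) auto
  have int: "integrable M (\<lambda>\<omega>. exp (y * \<xi> k \<omega>))" if "k \<in> I" for k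
  proof (rule integrable_const_bound[of _ "exp (cmod y * cmod a)"])
    show "AE \<omega> in M. norm (exp (y * \<xi> k \<omega>)) \<le> exp (cmod y * cmod a)"
      using step_bound[OF I(2)[OF that]]
    proof eventually_elim
      case (elim \<omega>)
      then have "cmod (y * \<xi> k \<omega>) \<le> cmod y * cmod a"
        by (simp add: norm_mult mult_left_mono)
      then show ?case by (intro order_trans[OF norm_exp]) simp
    qed
    show "(\<lambda>\<omega>. exp (y * \<xi> k \<omega>)) \<in> borel_measurable M"
      using measurable_step[OF I(2)[OF that]] by measurable
  qed
  have step: "(\<integral>\<omega>. exp (y * \<xi> k \<omega>) \<partial>M) = step_transform N a y" if "k \<in> I" for k
  proof -
    have "(\<integral>\<omega>. exp (y * \<xi> k \<omega>) \<partial>M) = (\<integral>z. exp (y * z) \<partial>distr M borel (\<xi> k))"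
      using measurable_step[OF I(2)[OF that]] by (subst integral_distr) auto
    then show ?thesis
      using law[OF I(2)[OF that]] integral_uniform_scaled_roots[OF N, of "\<lambda>z. exp (y * z)"]
      by (simp add: step_transform_def)
  qed
  have "exp (x * scaled_walk N \<xi> n t \<omega>) = (\<Prod>k\<in>I. exp (y * \<xi> k \<omega>))" for \<omega>
    using I(1) by (simp add: scaled_walk_def I_def y_def exp_sum[symmetric] sum_distrib_left mult.assoc)
  then have "(\<integral>\<omega>. exp (x * scaled_walk N \<xi> n t \<omega>) \<partial>M) = (\<integral>\<omega>. (\<Prod>k\<in>I. exp (y * \<xi> k \<omega>)) \<partial>M)"
    by simp
  also have "\<dots> = (\<Prod>k\<in>I. \<integral>\<omega>. exp (y * \<xi> k \<omega>) \<partial>M)"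
    by (rule indep_vars_lebesgue_integral[OF I(1) ind int])
  also have "\<dots> = step_transform N a y ^ nat \<lfloor>real n * t\<rfloor>"
    by (simp add: step I(3))
  finally show ?thesis by (simp only: y_def)
qed

text \<open>
The exponential generating function of the moments is the transform of the walk. Reading its
coefficients as derivatives at \<open>0\<close> opens the moments to Cauchy's estimates.
\<close>

lemma walk_moment:
  "(\<integral>\<omega>. scaled_walk N \<xi> n t \<omega> ^ k \<partial>M) / fact k
   = (deriv ^^ k) (\<lambda>x. step_transform N a (x * of_real (real n powr (- 1 / real N))) ^ nat \<lfloor>real n * t\<rfloor>) 0
       / fact k"
proof (rule power_series_coefficient[symmetric])
  fix x :: complex
  have "(\<lambda>k. x ^ k / fact k * w ^ k) sums exp (x * w)" for w
    using exp_converges[of "x * w"] by (simp add: scaleR_conv_of_real power_mult_distrib field_simps)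
  from expectation_power_series(2)[OF measurable_walk walk_bound this]
  show "(\<lambda>k. (\<integral>\<omega>. scaled_walk N \<xi> n t \<omega> ^ k \<partial>M) / fact k * x ^ k) sums
      step_transform N a (x * of_real (real n powr (- 1 / real N))) ^ nat \<lfloor>real n * t\<rfloor>"
    unfolding expectation_exp_walk by (simp add: mult.commute)
qed

lemma entire_walk_expectation:
  assumes "f holomorphic_on UNIV"
  shows "integrable M (\<lambda>\<omega>. f (z + scaled_walk N \<xi> n t \<omega>))"
    and "(\<lambda>k. (deriv ^^ k) f z * ((\<integral>\<omega>. scaled_walk N \<xi> n t \<omega> ^ k \<partial>M) / fact k))
          sums walk_expectation M N \<xi> f n t z"
  using expectation_power_series[OF measurable_walk walk_bound entire_taylor_sums[OF assms, of z]]
  by (simp_all add: walk_expectation_def)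

text \<open>The moments of the walk, divided by factorials, are the Taylor coefficients at \<open>0\<close> of the transform
\<open>\<Phi> n\<close>. Uniform convergence of \<open>\<Phi> n\<close> on a disc gives convergence of each coefficient, and Cauchy's
inequality on the circle of radius \<open>2 * R\<close> bounds the \<open>k\<close>-th one by a multiple of \<open>1 / (2 * R) ^ k\<close>.
Against derivatives growing like \<open>R ^ k\<close> this leaves a geometric series, so that Tannery's theorem
applies.\<close>

lemma walk_expectation_tendsto:
  assumes f: "exponential_bound f K R" and t: "0 \<le> t"
  shows "(\<lambda>n. walk_expectation M N \<xi> f n t z)
           \<longlonglongrightarrow> exp_deriv N f (of_real t * (a ^ N / fact N)) z"
proof -
  define \<tau> where "\<tau> = of_real t * (a ^ N / fact N)"
  define r where "r n = complex_of_real (real n powr (- 1 / real N))" for n :: nat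
  define \<Phi> where "\<Phi> n x = step_transform N a (x * r n) ^ nat \<lfloor>real n * t\<rfloor>" for n :: nat and x
  define p where "p x = a ^ N * x ^ N / fact N" for x :: complex
  \<comment> \<open>The open disc of radius \<open>D\<close> contains the circle of radius \<open>2 * R\<close> used in Cauchy's inequality.\<close>
  define D where "D = 2 * R + 1"
  define P where "P = cmod a ^ N * D ^ N / fact N"
  define Q where "Q = exp (D * cmod a) * (D * cmod a) ^ (2 * N)"
  define B where "B = exp ((P + Q) * t)"
  define C where "C = K * exp (R * cmod z) * B"
  have hol: "f holomorphic_on UNIV" and KR: "0 \<le> K" "1 \<le> R"
    and fbound: "\<And>k. cmod ((deriv ^^ k) f z) \<le> K * R ^ k * exp (R * cmod z)"
    using f by (auto simp: exponential_bound_def)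
  have D: "0 \<le> D" using KR by (simp add: D_def)
  have PQ: "0 \<le> P" "0 \<le> Q" using D by (auto simp: P_def Q_def)
  have p: "cmod (p x) \<le> P" if "x \<in> ball 0 D" for x
  proof -
    have "cmod a ^ N * cmod x ^ N / fact N \<le> P"
      unfolding P_def using that by (intro divide_right_mono mult_left_mono power_mono) auto
    then show ?thesis by (simp add: p_def norm_mult norm_divide norm_power)
  qed
  have step: "cmod (step_transform N a (x * r n) - 1 - p x / of_nat n) \<le> Q / (real n)\<^sup>2"
    if "n \<ge> 1" "x \<in> ball 0 D" for n x
    using scaled_step_transform_expansion[OF N that(1), of x D a] that(2)
    by (simp add: p_def Q_def r_def)
  have lim: "uniform_limit (ball 0 D) \<Phi> (\<lambda>x. exp (of_real t * p x)) sequentially"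
    unfolding \<Phi>_def by (rule compound_power_uniform_limit[OF t p step])
  have hol\<Phi>: "\<Phi> n holomorphic_on A" for n A
    unfolding \<Phi>_def step_transform_def by (intro holomorphic_intros) (use N in auto)
  have coeff_lim: "(\<lambda>n. (deriv ^^ k) (\<Phi> n) 0 / fact k)
      \<longlonglongrightarrow> (if N dvd k then \<tau> ^ (k div N) / fact (k div N) else 0)" for k
  proof -
    have "(\<lambda>n. (deriv ^^ k) (\<Phi> n) 0 / fact k)
        \<longlonglongrightarrow> (deriv ^^ k) (\<lambda>x. exp (of_real t * p x)) 0 / fact k"
      by (intro tendsto_divide tendsto_const higher_deriv_complex_uniform_limit[OF lim])
         (use hol\<Phi> KR in \<open>auto simp: D_def\<close>)
    moreover have "(\<lambda>x. exp (of_real t * p x)) = (\<lambda>x. exp (\<tau> * x ^ N))"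
      by (simp add: \<tau>_def p_def mult_ac)
    ultimately show ?thesis
      using power_series_coefficient[OF exp_monomial_sums[OF N]] by simp
  qed
  have coeff_bound: "cmod ((deriv ^^ k) (\<Phi> n) 0 / fact k) \<le> B / (2 * R) ^ k" if n: "n \<ge> 1" for n k
  proof -
    have "cmod (\<Phi> n x) \<le> B" if "cmod (0 - x) = 2 * R" for x
    proof -
      have x: "x \<in> ball 0 D" using that by (simp add: D_def)
      have "cmod (\<Phi> n x) \<le> exp ((P + Q) / real n) ^ nat \<lfloor>real n * t\<rfloor>"
        unfolding \<Phi>_def norm_power
        by (intro power_mono perturbed_factor_bound[OF p[OF x] n step[OF n x]]) auto
      also have "\<dots> \<le> B"
        unfolding B_def using PQ t n by (intro exp_power_floor_le) auto
      finally show ?thesis .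
    qed
    then have "cmod ((deriv ^^ k) (\<Phi> n) 0) \<le> fact k * B / (2 * R) ^ k"
      using KR by (intro Cauchy_inequality hol\<Phi> holomorphic_on_imp_continuous_on) auto
    then show ?thesis by (simp add: norm_divide field_simps)
  qed
  have term_bound: "cmod ((deriv ^^ k) f z * ((deriv ^^ k) (\<Phi> n) 0 / fact k)) \<le> C * (1 / 2) ^ k"
    if n: "n \<ge> 1" for n k
  proof -
    have "cmod ((deriv ^^ k) f z * ((deriv ^^ k) (\<Phi> n) 0 / fact k))
        \<le> (K * R ^ k * exp (R * cmod z)) * (B / (2 * R) ^ k)"
      unfolding norm_mult using KR by (intro mult_mono fbound coeff_bound[OF n]) auto
    also have "\<dots> = C * (1 / 2) ^ k"
      using KR by (simp add: C_def power_mult_distrib field_simps)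
    finally show ?thesis .
  qed
  have "(\<lambda>n. \<Sum>k. (deriv ^^ k) f z * ((deriv ^^ k) (\<Phi> n) 0 / fact k)) \<longlonglongrightarrow>
      (\<Sum>k. (deriv ^^ k) f z * (if N dvd k then \<tau> ^ (k div N) / fact (k div N) else 0))"
  proof (rule tannerys_theorem[THEN conjunct2, THEN conjunct2])
    show "\<forall>\<^sub>F (k, n) in at_top \<times>\<^sub>F sequentially.
        cmod ((deriv ^^ k) f z * ((deriv ^^ k) (\<Phi> n) 0 / fact k)) \<le> C * (1 / 2) ^ k"
      using eventually_prodI[OF always_eventually[of "\<lambda>_. True"] eventually_ge_at_top[of 1]]
      by (rule eventually_mono) (auto simp del: times_divide_eq_right intro!: term_bound)
    show "summable (\<lambda>k. C * (1 / 2) ^ k)" by (intro summable_mult summable_geometric) simp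
  qed (rule tendsto_mult[OF tendsto_const coeff_lim], simp)
  moreover have "(\<Sum>k. (deriv ^^ k) f z * ((deriv ^^ k) (\<Phi> n) 0 / fact k)) = walk_expectation M N \<xi> f n t z" for n
    using sums_unique[OF entire_walk_expectation(2)[OF hol, of z n t]]
    unfolding walk_moment \<Phi>_def r_def by (rule sym)
  moreover have "(\<Sum>k. (deriv ^^ k) f z * (if N dvd k then \<tau> ^ (k div N) / fact (k div N) else 0))
      = exp_deriv N f \<tau> z"
  proof -
    \<comment> \<open>Only multiples of \<open>N\<close> contribute, so the series may be summed over the quotients \<open>k div N\<close>.\<close>
    have "strict_mono (\<lambda>i. N * i)" using N by (simp add: strict_mono_def)
    then have "(\<Sum>i. (deriv ^^ (N * i)) f z
          * (if N dvd N * i then \<tau> ^ (N * i div N) / fact (N * i div N) else 0))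
        = (\<Sum>k. (deriv ^^ k) f z * (if N dvd k then \<tau> ^ (k div N) / fact (k div N) else 0))"
      by (rule suminf_mono_reindex) (auto simp: image_iff elim!: dvdE)
    then show ?thesis using N by (simp add: exp_deriv_def mult.commute)
  qed
  ultimately show ?thesis by (simp add: \<tau>_def)
qed

lemma limit_expectation_exists:
  assumes f: "exponential_bound f K R" and t: "0 \<le> t"
  shows "limit_expectation_exists M N \<xi> f t z"
  unfolding limit_expectation_exists_def convergent_def
  using f walk_expectation_tendsto[OF assms] by (auto intro!: entire_walk_expectation simp: exponential_bound_def)

lemma limit_expectation_eq:
  assumes f: "exponential_bound f K R" and t: "0 \<le> t"
  shows "limit_expectation M N \<xi> f t z = exp_deriv N f (of_real t * (a ^ N / fact N)) z"
  unfolding limit_expectation_def by (rule limI[OF walk_expectation_tendsto[OF assms]])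

end

theorem theorem18:
  fixes M :: "'a measure" and \<xi> :: "nat \<Rightarrow> 'a \<Rightarrow> complex"
    and N :: nat and \<alpha> a :: complex and g :: "complex \<Rightarrow> complex" and c :: real
  assumes "N > 2"
    and "a ^ N = \<alpha>"
    and "prob_space M"
    and "prob_space.indep_vars M (\<lambda>_. borel) \<xi> {1..}"
    and "\<And>k. k \<ge> 1 \<Longrightarrow> distr M borel (\<xi> k) = uniform_scaled_roots N a"
    and "exponential_type g c"
  shows "(\<forall>t\<ge>0. \<forall>z. limit_expectation_exists M N \<xi> g t z \<and>
                      limit_expectation_exists M N \<xi> ((deriv ^^ N) g) t z) \<and>
    integrated_equation N \<alpha> g (limit_expectation M N \<xi> g) (limit_expectation M N \<xi> ((deriv ^^ N) g)) \<and>
    (integrated_equation N \<alpha> g (limit_expectation M N \<xi> g) (limit_expectation M N \<xi> ((deriv ^^ N) g))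
       \<longleftrightarrow> classical_solution N \<alpha> g (limit_expectation M N \<xi> g))"
proof -
  interpret prob_space M by fact
  interpret roots_of_unity_walk M \<xi> N a
    by unfold_locales (use assms in auto)
  obtain K R where g: "exponential_bound g K R"
    using exponential_type_imp_bound[OF assms(6)] .
  note g' = exponential_bound_deriv[OF g, of N]
  have "integrated_equation N \<alpha> g (limit_expectation M N \<xi> g) (limit_expectation M N \<xi> ((deriv ^^ N) g))"
    by (rule exp_deriv_integrated_equation[OF g])
       (simp_all add: limit_expectation_eq[OF g] limit_expectation_eq[OF g'] assms(2))
  moreover have "classical_solution N \<alpha> g (limit_expectation M N \<xi> g)"
    by (rule exp_deriv_classical_solution[OF g])
       (simp add: fun_eq_iff limit_expectation_eq[OF g] assms(2))
  ultimately show ?thesis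
    using limit_expectation_exists[OF g] limit_expectation_exists[OF g'] by blast
qed

end
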